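(* Let $E/\mathbb{Q}$ be an elliptic curve with $j(E)=1728$ given by $E:y^2=x^3-Nx$ with $N>0$. Let $\zeta_{16}$ be a primitive $16$th root of unity and $\zeta_8=\zeta_{16}^2$. Then \begin{itemize} \item $\mathbb{Q}(E[4])=\mathbb{Q}(\zeta_8,\sqrt[4]{N})$, and \item $\mathbb{Q}(E[8])=\mathbb{Q}\left(\zeta_{16},\sqrt{-1+\sqrt2},\sqrt[4]{N}\right)$. \end{itemize}
   Context: $\mathbb{Q}(E[n])$ is the field generated over $\mathbb{Q}$ by the coordinates of the $n$-torsion points of $E(\overline{\mathbb{Q}})$. Here $N$ is a rational number. *)

theory Defs
  imports Complex_Main "HOL-Computational_Algebra.Polynomial" "HOL-Algebra.Generated_Fields"
    "HOL-Algebra.Algebraic_Closure_Type"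
begin

text \<open>
  Short Weierstrass curves \<open>y\<^sup>2 = x\<^sup>3 + A x + B\<close>; outside characteristic 2 and 3 every elliptic
  curve has such a model.
\<close>

datatype 'a short_weierstrass = Short_Weierstrass (coeff_A: 'a) (coeff_B: 'a)

definition discriminant :: "'a :: field short_weierstrass \<Rightarrow> 'a" where
  "discriminant E = -16 * (4 * coeff_A E ^ 3 + 27 * coeff_B E ^ 2)"

definition elliptic_curve :: "'a :: field short_weierstrass \<Rightarrow> bool" where
  "elliptic_curve E \<longleftrightarrow> discriminant E \<noteq> 0"

definition j_invariant :: "'a :: field short_weierstrass \<Rightarrow> 'a" where
  "j_invariant E = -1728 * (4 * coeff_A E) ^ 3 / discriminant E"

datatype (coords: 'a) point = Infinity | Point 'a 'a

fun on_curve :: "'a :: field short_weierstrass \<Rightarrow> 'a point \<Rightarrow> bool" where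
  "on_curve E Infinity \<longleftrightarrow> True"
| "on_curve E (Point x y) \<longleftrightarrow> y ^ 2 = x ^ 3 + coeff_A E * x + coeff_B E"

text \<open>
  The chord-tangent law. Two points of the curve with the same abscissa have equal or opposite
  ordinates, so after the first test \<open>x1 = x2\<close> means that the two points coincide and \<open>y1 \<noteq> 0\<close>.
\<close>

fun point_add :: "'a :: field short_weierstrass \<Rightarrow> 'a point \<Rightarrow> 'a point \<Rightarrow> 'a point" where
  "point_add E Infinity Q = Q"
| "point_add E (Point x1 y1) Infinity = Point x1 y1"
| "point_add E (Point x1 y1) (Point x2 y2) =
     (if x1 = x2 \<and> y1 = - y2 then Infinity
      else let m = (if x1 = x2 then (3 * x1 ^ 2 + coeff_A E) / (2 * y1)
                    else (y2 - y1) / (x2 - x1));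
               x3 = m ^ 2 - x1 - x2
           in Point x3 (m * (x1 - x3) - y1))"

text \<open>
  The group of points with coordinates in \<open>K\<close>, written multiplicatively as in the library,
  so that the multiple \<open>n P\<close> appears as the power \<open>P [^] n\<close>.
\<close>

definition point_group :: "'a :: field short_weierstrass \<Rightarrow> 'a set \<Rightarrow> 'a point monoid" where
  "point_group E K =
     \<lparr>carrier = {P. on_curve E P \<and> coords P \<subseteq> K}, monoid.mult = point_add E, one = Infinity\<rparr>"

text \<open>The algebraic closure of the rationals, taken inside the complex numbers.\<close>

definition Qbar :: "complex set" where
  "Qbar = {z. algebraic z}"

definition torsion_points :: "rat short_weierstrass \<Rightarrow> nat \<Rightarrow> complex point set" where
  "torsion_points E n =
     (let G = point_group (map_short_weierstrass of_rat E) Qbar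
      in {P \<in> carrier G. P [^]\<^bsub>G\<^esub> n = \<one>\<^bsub>G\<^esub>})"

text \<open>The subfield \<open>\<rat>(S)\<close> of the complex numbers.\<close>

definition rat_adjoin :: "complex set \<Rightarrow> complex set" where
  "rat_adjoin S = generate_field ring_of_type_algebra (\<rat> \<union> S)"

definition torsion_field :: "rat short_weierstrass \<Rightarrow> nat \<Rightarrow> complex set" where
  "torsion_field E n = rat_adjoin (\<Union>P\<in>torsion_points E n. coords P)"

definition primitive_root_of_unity :: "nat \<Rightarrow> 'a :: field \<Rightarrow> bool" where
  "primitive_root_of_unity n z \<longleftrightarrow> n > 0 \<and> z ^ n = 1 \<and> (\<forall>k\<in>{0<..<n}. z ^ k \<noteq> 1)"

end

theory Submission
  imports Defs
begin

text \<open>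
  Put \<open>a = root 4 N\<close> and \<open>s = a\<^sup>2\<close>, so that the curve is \<open>y\<^sup>2 = x (x - s) (x + s)\<close>. The proof rests on
  the 2-descent description of halving: a point that is not of order 2 and whose double has the
  abscissa \<open>x'\<close> is \<open>((r0 + r1) (r0 + r2), (r0 + r1) (r0 + r2) (r1 + r2))\<close>, where \<open>r0\<close>, \<open>r1\<close>, \<open>r2\<close> are
  square roots of \<open>x'\<close>, \<open>x' - s\<close>, \<open>x' + s\<close>; all such roots occur, and they are rational in
  the coordinates of the point and \<open>s\<close> (\<open>roots_of_half\<close> and \<open>half_of_roots\<close>). Hence adjoining the
  4-torsion means adjoining these roots for \<open>x' = 0, s, - s\<close>, and adjoining the 8-torsion means
  adjoining them for the abscissae \<open>x'\<close> of the points of order 4 as well, which are \<open>\<plusminus> \<i> s\<close>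
  and \<open>(\<plusminus> 1 \<plusminus> \<surd>2) s\<close>.

  For the 4-torsion the roots are \<open>a\<close> times \<open>0\<close> or square roots of \<open>\<plusminus> 1\<close> and \<open>\<plusminus> 2\<close>, which generate
  the field of \<open>a\<close>, \<open>\<i>\<close> and \<open>\<surd>2\<close>, and \<open>\<i>\<close> and \<open>\<surd>2\<close> generate the same field as a primitive eighth root
  of unity. For the 8-torsion one needs square roots of \<open>\<i>\<close>, \<open>\<i> \<plusminus> 1\<close>, \<open>\<surd>2\<close>, \<open>\<surd>2 \<plusminus> 1\<close>, \<open>2 \<plusminus> \<surd>2\<close> and
  their negatives. They are products of a sixteenth root of unity \<open>\<zeta>\<close>, of \<open>t\<close> with
  \<open>t\<^sup>2 = \<surd>2 - 1\<close>, and of \<open>w = \<zeta> + 1 / \<zeta>\<close> for a suitable choice of \<open>\<zeta>\<close>, because \<open>w\<^sup>2 = 2 + \<surd>2\<close>,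
  \<open>(w t)\<^sup>2 = \<surd>2\<close> and \<open>\<i> + 1 = \<surd>2 \<zeta>\<^sup>2\<close> when \<open>\<zeta>\<^sup>4 = \<i>\<close>. Conversely, \<open>\<zeta>\<close> is the quotient of square roots
  of \<open>\<i> + 1\<close> and \<open>\<surd>2\<close>.

  Torsion points are defined through the chord-tangent law, of which only two
  instances of associativity are required: the cancellation law \<open>point_add_add_neg\<close> and the equation
  \<open>4 P = 2 P + 2 P\<close> of \<open>point_mult_4\<close>. Together they reduce \<open>4 P = 0\<close> to \<open>2 (2 P) = 0\<close> and \<open>8 P = 0\<close>
  to \<open>4 (2 P) = 0\<close>.
\<close>

section \<open>Subfields of the complex numbers\<close>

text \<open>
  Subfields of the complex numbers, as sets. The inverse of \<open>0\<close> is \<open>0\<close>, so closure under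
  inversion needs no side condition.
\<close>

locale complex_subfield =
  fixes K :: "complex set"
  assumes Rats_subset: "\<rat> \<subseteq> K"
    and add_mem: "\<lbrakk>x \<in> K; y \<in> K\<rbrakk> \<Longrightarrow> x + y \<in> K"
    and uminus_mem: "x \<in> K \<Longrightarrow> - x \<in> K"
    and mult_mem: "\<lbrakk>x \<in> K; y \<in> K\<rbrakk> \<Longrightarrow> x * y \<in> K"
    and inverse_mem: "x \<in> K \<Longrightarrow> inverse x \<in> K"
begin

lemma diff_mem: "\<lbrakk>x \<in> K; y \<in> K\<rbrakk> \<Longrightarrow> x - y \<in> K"
  using add_mem[of x "- y"] uminus_mem by simp

lemma divide_mem: "\<lbrakk>x \<in> K; y \<in> K\<rbrakk> \<Longrightarrow> x / y \<in> K"
  using mult_mem[of x "inverse y"] inverse_mem by (simp add: divide_inverse)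

lemma numeral_mem: "0 \<in> K" "1 \<in> K" "numeral n \<in> K"
  using Rats_subset by auto

lemma power_mem: "x \<in> K \<Longrightarrow> x ^ n \<in> K"
  by (induction n) (auto intro: mult_mem numeral_mem)

lemmas mem_intros =
  add_mem uminus_mem mult_mem inverse_mem diff_mem divide_mem numeral_mem power_mem

lemma square_root_mem:
  assumes "w \<in> K" "r ^ 2 = w ^ 2"
  shows "r \<in> K"
  using assms uminus_mem by (auto simp: power2_eq_iff)

end

lemma ring_of_type_algebra_simps:
  "carrier ring_of_type_algebra = UNIV"
  "x \<otimes>\<^bsub>ring_of_type_algebra\<^esub> y = x * y"
  "x \<oplus>\<^bsub>ring_of_type_algebra\<^esub> y = x + y"
  "\<one>\<^bsub>ring_of_type_algebra\<^esub> = 1"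
  "\<zero>\<^bsub>ring_of_type_algebra\<^esub> = 0"
  by (simp_all add: ring_of_type_algebra_def)

lemma ring_of_type_algebra_uminus:
  "\<ominus>\<^bsub>ring_of_type_algebra\<^esub> x = - (x :: 'a :: field)"
proof -
  interpret field "ring_of_type_algebra :: 'a ring" ..
  show ?thesis
    by (rule minus_equality) (simp_all add: ring_of_type_algebra_simps)
qed

lemma ring_of_type_algebra_inv:
  "x \<noteq> 0 \<Longrightarrow> inv\<^bsub>ring_of_type_algebra\<^esub> x = inverse (x :: 'a :: field)"
proof -
  interpret field "ring_of_type_algebra :: 'a ring" ..
  show "x \<noteq> 0 \<Longrightarrow> inv\<^bsub>ring_of_type_algebra\<^esub> x = inverse x"
    by (rule comm_inv_char) (simp_all add: ring_of_type_algebra_simps)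
qed

lemmas ring_of_type_algebra_eqs =
  ring_of_type_algebra_simps ring_of_type_algebra_uminus ring_of_type_algebra_inv

lemma rat_adjoin_incl: "x \<in> S \<Longrightarrow> x \<in> rat_adjoin S"
  unfolding rat_adjoin_def by (auto intro: generate_field.incl)

lemma complex_subfield_rat_adjoin: "complex_subfield (rat_adjoin S)"
proof
  note rules = generate_field.intros[where R = "ring_of_type_algebra :: complex ring" and H = "\<rat> \<union> S"]
  show "\<rat> \<subseteq> rat_adjoin S"
    unfolding rat_adjoin_def by (auto intro: generate_field.incl)
  fix x y assume x: "x \<in> rat_adjoin S"
  show "- x \<in> rat_adjoin S"
    using rules(3)[of x] x by (simp add: rat_adjoin_def ring_of_type_algebra_eqs)
  show "inverse x \<in> rat_adjoin S"
    using rules(4)[of x] x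
    by (cases "x = 0") (simp_all add: rat_adjoin_def ring_of_type_algebra_eqs)
  assume y: "y \<in> rat_adjoin S"
  show "x + y \<in> rat_adjoin S"
    using rules(5)[of x y] x y by (simp add: rat_adjoin_def ring_of_type_algebra_eqs)
  show "x * y \<in> rat_adjoin S"
    using rules(6)[of x y] x y by (simp add: rat_adjoin_def ring_of_type_algebra_eqs)
qed

lemma rat_adjoin_least:
  assumes "complex_subfield K" "S \<subseteq> K"
  shows "rat_adjoin S \<subseteq> K"
proof
  interpret complex_subfield K by fact
  fix x assume "x \<in> rat_adjoin S"
  then show "x \<in> K"
    unfolding rat_adjoin_def
    by (induction rule: generate_field.induct)
      (use assms Rats_subset in \<open>auto simp: ring_of_type_algebra_eqs intro: mem_intros\<close>)
qed

text \<open>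
  Closure of the algebraic numbers under sums and products is the theorem that the elements
  algebraic over a subfield form a subfield. It is stated for polynomials encoded as lists with
  the leading coefficient first, so most of the proof compares the two notions of algebraicity.
\<close>

lemma complex_subfield_Qbar: "complex_subfield Qbar"
proof -
  let ?R = "ring_of_type_algebra :: complex ring"
  interpret R: field ?R ..
  have eval: "R.eval p x = poly (Poly (rev p)) x" for p x
  proof (induction p)
    case (Cons c p)
    have "x [^]\<^bsub>?R\<^esub> n = x ^ n" for n :: nat
      by (induction n) (simp_all add: ring_of_type_algebra_simps)
    with Cons show ?case
      by (simp add: ring_of_type_algebra_simps Poly_append poly_monom)
  qed (simp add: ring_of_type_algebra_simps)
  have sub: "subfield \<rat> ?R"
    by (intro R.subfieldI' R.subringI)
      (auto simp: ring_of_type_algebra_eqs)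
  have iff: "algebraic x \<longleftrightarrow> (R.algebraic over \<rat>) x" for x
  proof
    assume "algebraic x"
    then obtain p where p: "\<And>i. coeff p i \<in> \<rat>" "p \<noteq> 0" "poly p x = 0"
      by (auto simp: algebraic_altdef)
    show "(R.algebraic over \<rat>) x"
    proof (rule R.algebraicI)
      show "rev (coeffs p) \<in> carrier (\<rat> [X]\<^bsub>?R\<^esub>)"
        using p by (auto simp: univ_poly_def polynomial_def ring_of_type_algebra_eqs hd_rev
          last_coeffs_eq_coeff_degree coeffs_def)
    qed (use p in \<open>auto simp: eval ring_of_type_algebra_eqs\<close>)
  next
    assume "(R.algebraic over \<rat>) x"
    with R.algebraicE[OF subfieldE(1)[OF sub]] obtain p where
      p: "p \<in> carrier (\<rat> [X]\<^bsub>?R\<^esub>)" "p \<noteq> []" "R.eval p x = \<zero>\<^bsub>?R\<^esub>"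
      by (auto simp: ring_of_type_algebra_simps)
    then have p': "set p \<subseteq> \<rat>" "hd p \<noteq> 0"
      by (auto simp: univ_poly_def polynomial_def ring_of_type_algebra_eqs)
    show "algebraic x"
    proof (rule algebraicI')
      show "coeff (Poly (rev p)) i \<in> \<rat>" for i
        using p' by (auto simp: nth_default_def rev_nth subset_iff)
      have "coeff (Poly (rev p)) (length p - 1) = hd p"
        using p(2) by (simp add: nth_default_def rev_nth hd_conv_nth)
      with p'(2) show "Poly (rev p) \<noteq> 0"
        by (metis coeff_0)
      show "poly (Poly (rev p)) x = 0"
        using p(3) by (simp add: eval ring_of_type_algebra_simps)
    qed
  qed
  let ?A = "{x \<in> carrier ?R. (R.algebraic over \<rat>) x}"
  have A: "?A = Qbar"
    by (auto simp: Qbar_def iff ring_of_type_algebra_simps)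
  have "subfield Qbar ?R"
    using R.subfield_of_algebraics[OF sub] unfolding A .
  note subring = subringE[OF subfieldE(1)[OF this]]
  show ?thesis
  proof
    show "\<rat> \<subseteq> Qbar"
      by (auto simp: Qbar_def intro: rat_imp_algebraic)
    show "x + y \<in> Qbar" "x * y \<in> Qbar" if "x \<in> Qbar" "y \<in> Qbar" for x y
      using subring(6,7)[OF that] by (simp_all add: ring_of_type_algebra_simps)
    show "- x \<in> Qbar" "inverse x \<in> Qbar" if "x \<in> Qbar" for x
      using that by (auto simp: Qbar_def)
  qed
qed

context complex_subfield
begin

text \<open>The element \<open>c\<close> is a square of the subfield.\<close>

definition square_in :: "complex \<Rightarrow> bool" where
  "square_in c \<longleftrightarrow> (\<exists>w\<in>K. c = w ^ 2)"

lemma square_inI: "w \<in> K \<Longrightarrow> c = w ^ 2 \<Longrightarrow> square_in c"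
  by (auto simp: square_in_def)

lemma square_in_mult: "square_in c \<Longrightarrow> square_in d \<Longrightarrow> square_in (c * d)"
  unfolding square_in_def by (metis mult_mem power_mult_distrib)

lemma square_in_inverse: "square_in c \<Longrightarrow> square_in (inverse c)"
  unfolding square_in_def by (metis inverse_mem power_inverse)

lemma square_in_uminus: "square_in (- 1) \<Longrightarrow> square_in c \<Longrightarrow> square_in (- c)"
  using square_in_mult[of "- 1" c] by simp

lemma square_in_0_1: "square_in 0" "square_in 1"
  by (auto simp: square_in_def intro!: bexI[of _ 0] bexI[of _ 1] numeral_mem)

lemma square_in_imp_mem: "square_in (r ^ 2) \<Longrightarrow> r \<in> K"
  unfolding square_in_def using square_root_mem by blast

lemma square_in_mem: "square_in c \<Longrightarrow> c \<in> K"
  unfolding square_in_def using power_mem by blast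

end

lemma Qbar_square_root: "r ^ 2 \<in> Qbar \<Longrightarrow> r \<in> Qbar"
proof -
  assume "r ^ 2 \<in> Qbar"
  then have "algebraic (poly (monom 1 2) r)"
    by (simp add: Qbar_def poly_monom)
  then show "r \<in> Qbar"
    unfolding Qbar_def by (auto intro!: algebraic_root[of "r ^ 2" "monom 1 2"] simp: poly_monom degree_monom_eq)
qed

section \<open>Multiples of a point on an elliptic curve\<close>

text \<open>The inverse of a point for the chord-tangent law, by reflection in the axis.\<close>

fun point_neg :: "'a :: field point \<Rightarrow> 'a point" where
  "point_neg Infinity = Infinity"
| "point_neg (Point x y) = Point x (- y)"

text \<open>
  The multiple \<open>n P\<close> as \<open>(\<dots> (P + P) + \<dots>) + P\<close>. Associativity is not assumed, so this
  bracketing matters.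
\<close>

primrec point_mult :: "'a :: field short_weierstrass \<Rightarrow> nat \<Rightarrow> 'a point \<Rightarrow> 'a point" where
  "point_mult E 0 P = Infinity"
| "point_mult E (Suc n) P = point_add E (point_mult E n P) P"

text \<open>
  A division-free description of the slope \<open>m\<close> of the line through two points of the curve, which
  covers chords and tangents alike: the second equation is the difference of the two curve
  equations with the factor \<open>x2 - x1\<close> cancelled, and for coinciding points it is the equation of
  the tangent slope.
\<close>

definition line_slope :: "'a :: field short_weierstrass \<Rightarrow> 'a \<Rightarrow> 'a \<Rightarrow> 'a \<Rightarrow> 'a \<Rightarrow> 'a \<Rightarrow> bool" where
  "line_slope E x1 y1 x2 y2 m \<longleftrightarrow>
     y2 - y1 = m * (x2 - x1) \<and> m * (y1 + y2) = x1 ^ 2 + x1 * x2 + x2 ^ 2 + coeff_A E"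

context
  fixes E :: "'a :: field_char_0 short_weierstrass"
begin

lemma point_add_chord:
  assumes "x1 \<noteq> x2" "y2 - y1 = m * (x2 - x1)"
  shows "point_add E (Point x1 y1) (Point x2 y2) =
    Point (m ^ 2 - x1 - x2) (m * (x1 - (m ^ 2 - x1 - x2)) - y1)"
proof -
  have "m = (y2 - y1) / (x2 - x1)"
    using assms(1) unfolding assms(2) by simp
  with assms(1) show ?thesis by (simp add: Let_def)
qed

lemma point_add_tangent:
  assumes "y \<noteq> 0" "2 * y * m = 3 * x ^ 2 + coeff_A E"
  shows "point_add E (Point x y) (Point x y) =
    Point (m ^ 2 - 2 * x) (m * (x - (m ^ 2 - 2 * x)) - y)"
proof -
  have "m = (3 * x ^ 2 + coeff_A E) / (2 * y)"
    using assms(1) by (simp flip: assms(2))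
  moreover have "m ^ 2 - x - x = m ^ 2 - 2 * x"
    by simp
  ultimately show ?thesis
    using assms(1) by (simp add: Let_def)
qed

lemma point_add_line:
  assumes "line_slope E x1 y1 x2 y2 m" "\<not> (x1 = x2 \<and> y1 = - y2)"
  shows "point_add E (Point x1 y1) (Point x2 y2) =
    Point (m ^ 2 - x1 - x2) (m * (x1 - (m ^ 2 - x1 - x2)) - y1)"
proof (cases "x1 = x2")
  case True
  with assms have y: "y2 = y1" "y1 \<noteq> 0" "2 * y1 * m = 3 * x1 ^ 2 + coeff_A E"
    by (auto simp: line_slope_def power2_eq_square algebra_simps)
  have "m ^ 2 - x1 - x2 = m ^ 2 - 2 * x1"
    using True by simp
  then show ?thesis
    using point_add_tangent[OF y(2,3)] y(1) True by (simp only:)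
qed (use assms point_add_chord in \<open>auto simp: line_slope_def\<close>)

lemma line_slope_exists:
  assumes "on_curve E (Point x1 y1)" "on_curve E (Point x2 y2)" "\<not> (x1 = x2 \<and> y1 = - y2)"
  obtains m where "line_slope E x1 y1 x2 y2 m"
proof (cases "x1 = x2")
  case True
  with assms have "y1 ^ 2 = y2 ^ 2" "y1 \<noteq> - y2"
    by auto
  then have "y2 = y1" "y1 \<noteq> 0"
    by (auto simp: power2_eq_iff)
  with True have "line_slope E x1 y1 x2 y2 ((3 * x1 ^ 2 + coeff_A E) / (2 * y1))"
    by (simp add: line_slope_def field_simps power2_eq_square)
  then show ?thesis by (rule that)
next
  case False
  let ?m = "(y2 - y1) / (x2 - x1)"
  have "?m * (x2 - x1) = y2 - y1"
    using False by simp
  then have "(x2 - x1) * (?m * (y1 + y2)) = (y2 - y1) * (y1 + y2)"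
    by (simp only: mult.assoc[symmetric] mult.commute[of "x2 - x1"])
  also have "\<dots> = (x2 - x1) * (x1 ^ 2 + x1 * x2 + x2 ^ 2 + coeff_A E)"
    using assms(1,2) by (simp add: algebra_simps power2_eq_square power3_eq_cube)
  finally have "line_slope E x1 y1 x2 y2 ?m"
    using False by (simp add: line_slope_def)
  then show ?thesis by (rule that)
qed

text \<open>
  With \<open>Point x3 y3\<close> the sum of the two points, the first statement says that the sum and the
  negative of the second point lie on the reflected line. This is what makes subtraction undo
  addition.
\<close>

lemma line_third_point:
  assumes "line_slope E x1 y1 x2 y2 m" "x3 = m ^ 2 - x1 - x2" "y3 = m * (x1 - x3) - y1"
  shows "line_slope E x3 y3 x2 (- y2) (- m)"
    and "on_curve E (Point x1 y1) \<Longrightarrow> on_curve E (Point x3 y3)"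
proof -
  from assms(1) have y2: "y2 = y1 + m * (x2 - x1)"
    and A: "coeff_A E = m * (y1 + y2) - x1 ^ 2 - x1 * x2 - x2 ^ 2"
    by (auto simp: line_slope_def algebra_simps)
  show "line_slope E x3 y3 x2 (- y2) (- m)"
    unfolding line_slope_def A assms(2,3) y2
    by (simp add: algebra_simps power2_eq_square)
  assume "on_curve E (Point x1 y1)"
  then have B: "coeff_B E = y1 ^ 2 - x1 ^ 3 - coeff_A E * x1"
    by simp
  show "on_curve E (Point x3 y3)"
    unfolding on_curve.simps B A assms(2,3) y2
    by (simp add: algebra_simps power2_eq_square power3_eq_cube)
qed

lemma on_curve_point_neg: "on_curve E P \<Longrightarrow> on_curve E (point_neg P)"
  by (cases P) auto

lemma point_neg_neg: "point_neg (point_neg P) = (P :: 'a point)"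
  by (cases P) auto

lemma point_add_eq_Infinity_iff: "point_add E P Q = Infinity \<longleftrightarrow> P = point_neg Q"
  by (cases P; cases Q) (auto simp: Let_def)

lemma on_curve_point_add:
  assumes "on_curve E P" "on_curve E Q"
  shows "on_curve E (point_add E P Q)"
proof (cases P; cases Q)
  fix x1 y1 x2 y2 assume P: "P = Point x1 y1" and Q: "Q = Point x2 y2"
  show ?thesis
  proof (cases "x1 = x2 \<and> y1 = - y2")
    case False
    then obtain m where m: "line_slope E x1 y1 x2 y2 m"
      using line_slope_exists assms P Q by metis
    from line_third_point(2)[OF m refl refl] show ?thesis
      using assms(1) unfolding P Q point_add_line[OF m False] by blast
  qed (auto simp: P Q)
qed (use assms in auto)

lemma point_neg_add: "point_neg (point_add E P Q) = point_add E (point_neg P) (point_neg Q)"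
proof (cases P; cases Q)
  fix x1 y1 x2 y2 assume PQ: "P = Point x1 y1" "Q = Point x2 y2"
  have "(- y2 + y1) / (x2 - x1) = - ((y2 - y1) / (x2 - x1))"
    by (simp add: divide_simps)
  then show ?thesis
    by (auto simp: PQ Let_def power_divide algebra_simps minus_equation_iff)
qed auto

text \<open>
  The instance \<open>(P + Q) + (- Q) = P\<close> of associativity. Adding back along the reflected line
  returns to \<open>P\<close>, unless that line is vertical; this would make \<open>Q\<close> a point with vanishing
  ordinate at which the derivative of the cubic vanishes, that is, a singular point.
\<close>

lemma point_add_add_neg:
  assumes "elliptic_curve E" "on_curve E P" "on_curve E Q"
  shows "point_add E (point_add E P Q) (point_neg Q) = P"
proof (cases P; cases Q)
  fix x1 y1 x2 y2 assume P: "P = Point x1 y1" and Q: "Q = Point x2 y2"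
  show ?thesis
  proof (cases "x1 = x2 \<and> y1 = - y2")
    case False
    then obtain m where m: "line_slope E x1 y1 x2 y2 m"
      using line_slope_exists assms P Q by metis
    define x3 where "x3 = m ^ 2 - x1 - x2"
    define y3 where "y3 = m * (x1 - x3) - y1"
    have m': "line_slope E x3 y3 x2 (- y2) (- m)"
      using line_third_point(1)[OF m x3_def y3_def] .
    have ne: "\<not> (x3 = x2 \<and> y3 = - (- y2))"
    proof
      assume "x3 = x2 \<and> y3 = - (- y2)"
      then have "2 * y2 = 0" "3 * x2 ^ 2 + coeff_A E = 0"
        using m' by (auto simp: line_slope_def power2_eq_square)
      moreover from this(1) have "0 = x2 ^ 3 + coeff_A E * x2 + coeff_B E"
        using assms(3) by (simp add: Q)
      ultimately have A: "coeff_A E = - 3 * x2 ^ 2" and "coeff_B E = - (x2 ^ 3) - coeff_A E * x2"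
        by (auto simp: eq_neg_iff_add_eq_0 algebra_simps)
      then have B: "coeff_B E = 2 * x2 ^ 3"
        by (simp add: power2_eq_square power3_eq_cube)
      have "discriminant E = 0"
        by (simp add: discriminant_def A B power_mult_distrib flip: power_mult)
      with assms(1) show False by (simp add: elliptic_curve_def)
    qed
    have "point_add E (Point x3 y3) (Point x2 (- y2)) = Point x1 y1"
      unfolding point_add_line[OF m' ne] by (simp add: x3_def y3_def algebra_simps)
    then show ?thesis
      unfolding P Q point_add_line[OF m False] point_neg.simps x3_def y3_def .
  qed (auto simp: P Q)
qed (use assms in auto)

lemma on_curve_point_mult: "on_curve E P \<Longrightarrow> on_curve E (point_mult E n P)"
  by (induction n) (auto intro: on_curve_point_add)

text \<open>
  The relation \<open>(m + k) P = 0 \<longleftrightarrow> m P = - (k P)\<close>, obtained by moving one summand \<open>P\<close> at a time to the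
  other side with the cancellation law above.
\<close>

lemma point_mult_add_eq_Infinity_iff:
  assumes "elliptic_curve E" "on_curve E P"
  shows "point_mult E (m + k) P = Infinity \<longleftrightarrow> point_mult E m P = point_neg (point_mult E k P)"
proof (induction k arbitrary: m)
  case (Suc k)
  let ?neg = point_neg and ?add = "point_add E" and ?mult = "point_mult E"
  note on = on_curve_point_mult[OF assms(2)] on_curve_point_neg assms(2)
  have "?mult (m + Suc k) P = Infinity \<longleftrightarrow> ?add (?mult m P) P = ?neg (?mult k P)"
    using Suc.IH[of "Suc m"] by simp
  also have "\<dots> \<longleftrightarrow> ?mult m P = ?add (?neg (?mult k P)) (?neg P)"
    using point_add_add_neg[OF assms(1), of "?mult m P" P]
      point_add_add_neg[OF assms(1), of "?neg (?mult k P)" "?neg P"] on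
    by (metis point_neg_neg)
  finally show ?case by (simp add: point_neg_add)
qed simp

text \<open>
  The instance \<open>((P + P) + P) + P = (P + P) + (P + P)\<close> of associativity.
\<close>

lemma point_mult_4:
  assumes "elliptic_curve E" "on_curve E P"
  shows "point_mult E 4 P = point_add E (point_add E P P) (point_add E P P)"
proof (cases P)
  case (Point x y)
  let ?neg = point_neg and ?add = "point_add E"
  define Q where "Q = ?add P P"
  note on = on_curve_point_neg assms(2)
  have mult: "point_mult E 4 P = ?add (?add Q P) P"
    by (simp add: Q_def numeral_eq_Suc)
  consider "y = 0" | "y \<noteq> 0" "Q = ?neg P" | "y \<noteq> 0" "Q = ?neg Q" | "y \<noteq> 0" "Q \<noteq> ?neg P" "Q \<noteq> ?neg Q"
    by blast
  then have "?add (?add Q P) P = ?add Q Q"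
  proof cases
    case 1
    then have "Q = Infinity" by (simp add: Q_def Point)
    then show ?thesis by (simp add: Q_def)
  next
    case 2
    then have "?add Q Q = ?neg Q"
      by (simp only: Q_def flip: point_neg_add)
    with 2 show ?thesis
      by (metis point_add_eq_Infinity_iff point_add.simps(1) point_neg_neg)
  next
    case 3
    then have "Q = ?add (?neg P) (?neg P)"
      by (simp add: Q_def point_neg_add)
    then have "?add Q P = ?neg P"
      using point_add_add_neg[OF assms(1), of "?neg P" "?neg P"] on by (simp add: point_neg_neg)
    then have "?add (?add Q P) P = Infinity"
      by (simp add: point_add_eq_Infinity_iff)
    moreover have "?add Q Q = Infinity"
      using 3 by (simp add: point_add_eq_Infinity_iff)
    ultimately show ?thesis by simp
  next
    case 4
    \<comment> \<open>In the generic case every quantity is a polynomial in \<open>m\<close>, \<open>c\<close> and \<open>q\<close> (up to a division by 3):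
      \<open>m\<close> is the slope of the tangent at \<open>P\<close>, \<open>m - 2 c\<close> that of the line through \<open>2 P\<close> and \<open>P\<close>,
      \<open>q - m\<close> that of the tangent at \<open>2 P\<close>, and \<open>q - m + 2 c\<close> that of the line through \<open>3 P\<close>
      and \<open>P\<close>. The claim then becomes a polynomial identity.\<close>
    define m where "m = (3 * x ^ 2 + coeff_A E) / (2 * y)"
    have m: "2 * y * m = 3 * x ^ 2 + coeff_A E"
      using 4 by (simp add: m_def)
    define d where "d = m ^ 2 - 3 * x"
    define y2 where "y2 = - m * d - y"
    have Q: "Q = Point (x + d) y2"
      unfolding Q_def Point point_add_tangent[OF \<open>y \<noteq> 0\<close> m]
      by (simp add: d_def y2_def algebra_simps)
    have ne: "d \<noteq> 0" "y2 \<noteq> 0"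
      using 4 by (auto simp: Q Point y2_def)
    define c where "c = - y2 / d"
    define q where "q = - d / (2 * c)"
    have "c \<noteq> 0"
      using ne by (simp add: c_def)
    have d: "d = - 2 * c * q"
      using \<open>c \<noteq> 0\<close> by (simp add: q_def)
    have "y2 = - c * d"
      using ne by (simp add: c_def)
    then have y2: "y2 = 2 * c ^ 2 * q"
      by (simp add: d power2_eq_square)
    have y: "y = 2 * c * q * (m - c)"
      using y2_def by (simp add: y2 d algebra_simps power2_eq_square)
    have x: "x = (m ^ 2 + 2 * c * q) / 3"
      using d_def by (simp add: d field_simps)
    have A: "coeff_A E = 2 * y * m - 3 * x ^ 2"
      using m by simp
    define x3 where "x3 = x + 4 * c * (c - m)"
    define y3 where "y3 = (m - 2 * c) * (x - x3) - y"
    have "x3 \<noteq> x"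
      using \<open>c \<noteq> 0\<close> \<open>y \<noteq> 0\<close> by (auto simp: x3_def y)
    have "y - y2 = (m - 2 * c) * (x - (x + d))"
      by (simp add: y y2 d algebra_simps power2_eq_square)
    from point_add_chord[OF _ this] have "?add Q P = Point x3 y3"
      using ne(1) unfolding Q Point
      by (simp add: x3_def y3_def y y2 d x field_simps power2_eq_square)
    moreover have "y - y3 = (q - m + 2 * c) * (x - x3)"
      by (simp add: y3_def x3_def y algebra_simps power2_eq_square)
    from point_add_chord[OF \<open>x3 \<noteq> x\<close> this] have "?add (Point x3 y3) P =
        Point ((q - m) ^ 2 - 2 * (x + d))
          ((q - m) * (x + d - ((q - m) ^ 2 - 2 * (x + d))) - y2)"
      unfolding Point
      by (simp add: x3_def y3_def y y2 d x field_simps power2_eq_square)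
    moreover have "2 * y2 * (q - m) = 3 * (x + d) ^ 2 + coeff_A E"
      by (simp add: A y y2 d x field_simps power2_eq_square)
    from point_add_tangent[OF \<open>y2 \<noteq> 0\<close> this] have "?add Q Q =
        Point ((q - m) ^ 2 - 2 * (x + d))
          ((q - m) * (x + d - ((q - m) ^ 2 - 2 * (x + d))) - y2)"
      unfolding Q .
    ultimately show ?thesis by simp
  qed
  then show ?thesis by (simp add: mult flip: Q_def)
qed (simp add: numeral_eq_Suc)

end

lemma point_mult_2: "point_mult E 2 P = point_add E P P"
  by (simp add: numeral_2_eq_2)

context
  fixes E :: "'a :: field_char_0 short_weierstrass" and P :: "'a point"
  assumes E: "elliptic_curve E" and P: "on_curve E P"
begin

lemma point_mult_2_eq_Infinity_iff: "point_mult E 2 P = Infinity \<longleftrightarrow> P = point_neg P"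
  by (simp add: point_mult_2 point_add_eq_Infinity_iff)

lemma point_mult_4_eq_Infinity_iff:
  "point_mult E 4 P = Infinity \<longleftrightarrow> point_add E P P = point_neg (point_add E P P)"
  by (simp add: point_mult_4[OF E P] point_add_eq_Infinity_iff)

lemma point_mult_8_eq_Infinity_iff:
  "point_mult E 8 P = Infinity \<longleftrightarrow> point_mult E 4 (point_add E P P) = Infinity"
proof -
  have "point_mult E 8 P = Infinity \<longleftrightarrow> point_add E (point_mult E 4 P) (point_mult E 4 P) = Infinity"
    using point_mult_add_eq_Infinity_iff[OF E P, of 4 4] by (simp add: point_add_eq_Infinity_iff)
  also have "\<dots> \<longleftrightarrow> point_mult E 4 (point_add E P P) = Infinity"
    by (simp only: point_mult_4[OF E P] point_mult_4[OF E on_curve_point_add[OF P P]])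
  finally show ?thesis .
qed

lemma point_mult_4_imp_8: "point_mult E 4 P = Infinity \<Longrightarrow> point_mult E 8 P = Infinity"
  using point_mult_add_eq_Infinity_iff[OF E P, of 4 4] by simp

end

lemma torsion_points_eq:
  "torsion_points E n =
    {P. on_curve (map_short_weierstrass of_rat E) P \<and> coords P \<subseteq> Qbar \<and>
        point_mult (map_short_weierstrass of_rat E) n P = Infinity}"
proof -
  have "P [^]\<^bsub>point_group E' K\<^esub> n = point_mult E' n P" for E' :: "complex short_weierstrass" and K P
    by (induction n) (simp_all add: point_group_def nat_pow_def)
  then show ?thesis
    by (auto simp: torsion_points_def Let_def) (auto simp: point_group_def)
qed

section \<open>Halving points and torsion on \<open>y\<^sup>2 = x (x - s) (x + s)\<close>\<close>

text \<open>
  The curve \<open>y\<^sup>2 = x\<^sup>3 - s\<^sup>2 x = x (x - s) (x + s)\<close>, whose points of order 2 have the abscissae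
  \<open>0\<close>, \<open>s\<close> and \<open>- s\<close>.
\<close>

locale congruent_curve =
  fixes s :: "'a :: field_char_0"
  assumes s_nz: "s \<noteq> 0"
begin

abbreviation E where "E \<equiv> Short_Weierstrass (- (s ^ 2)) 0"

lemma elliptic: "elliptic_curve E"
  using s_nz by (simp add: elliptic_curve_def discriminant_def)

lemma on_curve_iff: "on_curve E (Point x y) \<longleftrightarrow> y ^ 2 = x * (x - s) * (x + s)"
  by (simp add: algebra_simps power2_eq_square power3_eq_cube)

lemma ordinate_zero_iff:
  assumes "on_curve E (Point x y)"
  shows "y = 0 \<longleftrightarrow> x \<in> {0, s, - s}"
proof -
  have "y = 0 \<longleftrightarrow> y ^ 2 = 0"
    by simp
  also have "\<dots> \<longleftrightarrow> x * (x - s) * (x + s) = 0"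
    using assms unfolding on_curve_iff by simp
  finally have "y = 0 \<longleftrightarrow> x * (x - s) * (x + s) = 0" .
  then show ?thesis by (auto simp: eq_neg_iff_add_eq_0)
qed

text \<open>
  Halving by a 2-descent. If \<open>r0\<close>, \<open>r1\<close>, \<open>r2\<close> are square roots of \<open>x\<close>, \<open>x - s\<close>, \<open>x + s\<close>, then the
  point \<open>half r0 r1 r2\<close> lies on the curve and its double has the abscissa \<open>x\<close>. The ordinate of
  the double is one of the two possible ones; only abscissae are needed below.
\<close>

definition half :: "'a \<Rightarrow> 'a \<Rightarrow> 'a \<Rightarrow> 'a point" where
  "half r0 r1 r2 = Point ((r0 + r1) * (r0 + r2)) ((r1 + r2) * ((r0 + r1) * (r0 + r2)))"

text \<open>The relation between the three roots; the abscissa of the double is \<open>r0\<^sup>2\<close>.\<close>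

definition half_roots :: "'a \<Rightarrow> 'a \<Rightarrow> 'a \<Rightarrow> bool" where
  "half_roots r0 r1 r2 \<longleftrightarrow> r1 ^ 2 = r0 ^ 2 - s \<and> r2 ^ 2 = r0 ^ 2 + s"

text \<open>
  Conversely, every affine point that is not of order 2 arises in this way, with roots that are
  rational in its coordinates and \<open>s\<close>.
\<close>

lemma roots_of_half:
  assumes "on_curve E (Point x y)" "y \<noteq> 0"
  defines "r0 \<equiv> (x ^ 2 + s ^ 2) / (2 * y)"
    and "r1 \<equiv> (x ^ 2 - 2 * s * x - s ^ 2) / (2 * y)"
    and "r2 \<equiv> (x ^ 2 + 2 * s * x - s ^ 2) / (2 * y)"
  shows "half_roots r0 r1 r2" "Point x y = half r0 r1 r2"
    "\<exists>y'. point_add E (Point x y) (Point x y) = Point (r0 ^ 2) y'"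
proof -
  have ysq: "y ^ 2 = x * (x - s) * (x + s)"
    using assms(1) on_curve_iff by simp
  have sum: "r0 + r1 = x * (x - s) / y" "r0 + r2 = x * (x + s) / y" "r1 + r2 = (x - s) * (x + s) / y"
    using assms(2) by (simp_all add: r0_def r1_def r2_def field_simps power2_eq_square)
  have "(r0 + r1) * (r0 + r2) = x * (x * (x - s) * (x + s)) / y ^ 2"
    unfolding sum by (simp add: power2_eq_square)
  then have x: "(r0 + r1) * (r0 + r2) = x"
    using assms(2) by (simp flip: ysq)
  have "(r1 + r2) * x = x * (x - s) * (x + s) / y"
    unfolding sum by simp
  then have "(r1 + r2) * x = y"
    using assms(2) by (simp flip: ysq) (simp add: power2_eq_square)
  with x show "Point x y = half r0 r1 r2"
    by (simp add: half_def)
  have "r0 ^ 2 - r1 ^ 2 = (r0 + r1) * (r0 - r1)" "r2 ^ 2 - r0 ^ 2 = (r0 + r2) * (r2 - r0)"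
    by (simp_all add: algebra_simps power2_eq_square)
  moreover have "r0 - r1 = s * (x + s) / y" "r2 - r0 = s * (x - s) / y"
    using assms(2) by (simp_all add: r0_def r1_def r2_def field_simps power2_eq_square)
  ultimately have "r0 ^ 2 - r1 ^ 2 = s * (x * (x - s) * (x + s)) / y ^ 2"
    "r2 ^ 2 - r0 ^ 2 = s * (x * (x - s) * (x + s)) / y ^ 2"
    unfolding sum by (simp_all add: power2_eq_square)
  then have "r0 ^ 2 - r1 ^ 2 = s" "r2 ^ 2 - r0 ^ 2 = s"
    using assms(2) by (simp_all flip: ysq)
  then show "half_roots r0 r1 r2"
    by (auto simp: half_roots_def algebra_simps)
  define m where "m = (3 * x ^ 2 - s ^ 2) / (2 * y)"
  have m: "2 * y * m = 3 * x ^ 2 + coeff_A E"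
    using assms(2) by (simp add: m_def)
  have "(2 * y) ^ 2 * (m ^ 2 - 2 * x) = (3 * x ^ 2 - s ^ 2) ^ 2 - 8 * x * y ^ 2"
    using assms(2) by (simp add: m_def power_divide right_diff_distrib power_mult_distrib)
  also have "\<dots> = (x ^ 2 + s ^ 2) ^ 2"
    unfolding ysq by (simp add: algebra_simps power2_eq_square)
  finally have "m ^ 2 - 2 * x = r0 ^ 2"
    using assms(2) by (simp add: r0_def power_divide field_simps)
  then show "\<exists>y'. point_add E (Point x y) (Point x y) = Point (r0 ^ 2) y'"
    using point_add_tangent[OF assms(2) m] by auto
qed

lemma half_of_roots:
  assumes "half_roots r0 r1 r2"
  obtains x y where "half r0 r1 r2 = Point x y" "on_curve E (Point x y)" "y \<noteq> 0"
    "r0 = (x ^ 2 + s ^ 2) / (2 * y)"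
    "r1 = (x ^ 2 - 2 * s * x - s ^ 2) / (2 * y)"
    "r2 = (x ^ 2 + 2 * s * x - s ^ 2) / (2 * y)"
proof -
  define x y where "x = (r0 + r1) * (r0 + r2)" and "y = (r1 + r2) * x"
  from assms have s: "s = r0 ^ 2 - r1 ^ 2" and s': "s = r2 ^ 2 - r0 ^ 2"
    by (auto simp: half_roots_def)
  have xs: "x - s = (r0 + r1) * (r1 + r2)"
    unfolding s by (simp add: x_def algebra_simps power2_eq_square)
  have xs': "x + s = (r0 + r2) * (r1 + r2)"
    unfolding s' by (simp add: x_def algebra_simps power2_eq_square)
  have "(r0 + r1) * (r0 - r1) = s"
    unfolding s by (simp add: algebra_simps power2_eq_square)
  moreover have "(r0 + r2) * (r2 - r0) = s"
    unfolding s' by (simp add: algebra_simps power2_eq_square)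
  moreover have "2 * s = r2 ^ 2 - r1 ^ 2"
    using s s' by simp
  then have "(r1 + r2) * (r2 - r1) = 2 * s"
    by (simp add: algebra_simps power2_eq_square)
  ultimately have nz: "r0 + r1 \<noteq> 0" "r0 + r2 \<noteq> 0" "r1 + r2 \<noteq> 0"
    using s_nz by auto
  have y: "y \<noteq> 0"
    using nz by (simp add: y_def x_def)
  have on: "on_curve E (Point x y)"
    unfolding on_curve_iff xs xs' by (simp add: y_def x_def power2_eq_square)
  have "x ^ 2 + s ^ 2 = x ^ 2 + (r0 ^ 2 - r1 ^ 2) * (r2 ^ 2 - r0 ^ 2)"
    unfolding power2_eq_square[of s] by (simp flip: s s')
  also have "\<dots> = 2 * y * r0"
    by (simp add: y_def x_def algebra_simps power2_eq_square)
  finally have 0: "x ^ 2 + s ^ 2 = 2 * y * r0" .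
  have x1: "x * (x - s) = y * (r0 + r1)" and x2: "x * (x + s) = y * (r0 + r2)"
    unfolding xs xs' by (simp_all add: y_def x_def)
  have "x ^ 2 - 2 * s * x - s ^ 2 = 2 * (x * (x - s)) - (x ^ 2 + s ^ 2)"
    by (simp add: algebra_simps power2_eq_square)
  then have 1: "x ^ 2 - 2 * s * x - s ^ 2 = 2 * y * r1"
    unfolding x1 0 by (simp add: algebra_simps)
  have "x ^ 2 + 2 * s * x - s ^ 2 = 2 * (x * (x + s)) - (x ^ 2 + s ^ 2)"
    by (simp add: algebra_simps power2_eq_square)
  then have 2: "x ^ 2 + 2 * s * x - s ^ 2 = 2 * y * r2"
    unfolding x2 0 by (simp add: algebra_simps)
  show ?thesis
  proof (rule that[OF _ on y])
    show "half r0 r1 r2 = Point x y"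
      by (simp add: half_def x_def y_def)
  qed (use y in \<open>simp_all add: 0 1 2\<close>)
qed

lemma point_mult_2_half:
  assumes "half_roots r0 r1 r2"
  obtains y where "point_add E (half r0 r1 r2) (half r0 r1 r2) = Point (r0 ^ 2) y"
proof -
  obtain x y where xy: "half r0 r1 r2 = Point x y" "on_curve E (Point x y)" "y \<noteq> 0"
    "r0 = (x ^ 2 + s ^ 2) / (2 * y)"
    using half_of_roots[OF assms] by blast
  show ?thesis
    using roots_of_half(3)[OF xy(2,3)] that unfolding xy(1) by (auto simp flip: xy(4))
qed

lemma torsion_2_iff:
  assumes "on_curve E (Point x y)"
  shows "point_mult E 2 (Point x y) = Infinity \<longleftrightarrow> x \<in> {0, s, - s}"
  using point_mult_2_eq_Infinity_iff[OF elliptic assms] ordinate_zero_iff[OF assms]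
  by (auto simp: eq_neg_iff_add_eq_0)

lemma torsion_4_iff_double:
  assumes "on_curve E (Point x y)" "point_add E (Point x y) (Point x y) = Point x' y'"
  shows "point_mult E 4 (Point x y) = Infinity \<longleftrightarrow> x' \<in> {0, s, - s}"
proof -
  have "on_curve E (Point x' y')"
    using on_curve_point_add[OF assms(1,1)] assms(2) by simp
  then show ?thesis
    unfolding point_mult_4_eq_Infinity_iff[OF elliptic assms(1)] assms(2)
    by (simp only: point_neg.simps point.inject eq_neg_iff_add_eq_0 simp_thms flip: mult_2)
      (simp add: ordinate_zero_iff del: on_curve.simps)
qed

text \<open>
  The abscissa of \<open>2 (x, y)\<close> is \<open>0\<close>, \<open>s\<close> or \<open>- s\<close> exactly if one of the three roots vanishes. Their
  numerators are \<open>x\<^sup>2 + s\<^sup>2\<close>, \<open>(x - s)\<^sup>2 - 2 s\<^sup>2\<close> and \<open>(x + s)\<^sup>2 - 2 s\<^sup>2\<close>.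
\<close>

lemma torsion_4_iff:
  assumes "on_curve E (Point x y)"
  shows "point_mult E 4 (Point x y) = Infinity \<longleftrightarrow>
    x \<in> {0, s, - s} \<or> x ^ 2 + s ^ 2 = 0 \<or> (x - s) ^ 2 = 2 * s ^ 2 \<or> (x + s) ^ 2 = 2 * s ^ 2"
proof (cases "y = 0")
  case True
  then show ?thesis
    using point_mult_4_eq_Infinity_iff[OF elliptic assms] ordinate_zero_iff[OF assms] by auto
next
  case False
  define r0 where "r0 = (x ^ 2 + s ^ 2) / (2 * y)"
  define r1 where "r1 = (x ^ 2 - 2 * s * x - s ^ 2) / (2 * y)"
  define r2 where "r2 = (x ^ 2 + 2 * s * x - s ^ 2) / (2 * y)"
  note roots = roots_of_half[OF assms False, folded r0_def r1_def r2_def]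
  obtain y' where "point_add E (Point x y) (Point x y) = Point (r0 ^ 2) y'"
    using roots(3) by blast
  from torsion_4_iff_double[OF assms this]
  have "point_mult E 4 (Point x y) = Infinity \<longleftrightarrow> r0 ^ 2 = 0 \<or> r0 ^ 2 - s = 0 \<or> r0 ^ 2 + s = 0"
    by (auto simp: eq_neg_iff_add_eq_0)
  also have "\<dots> \<longleftrightarrow> r0 = 0 \<or> r1 = 0 \<or> r2 = 0"
    using roots(1) unfolding half_roots_def by (metis power_zero_numeral power_eq_0_iff)
  also have "\<dots> \<longleftrightarrow> x ^ 2 + s ^ 2 = 0 \<or> (x - s) ^ 2 = 2 * s ^ 2 \<or> (x + s) ^ 2 = 2 * s ^ 2"
    using False by (simp add: r0_def r1_def r2_def algebra_simps power2_eq_square)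
  finally show ?thesis
    using False ordinate_zero_iff[OF assms] by simp
qed

lemma torsion_8_half:
  assumes "half_roots r0 r1 r2"
    and "(r0 ^ 2) ^ 2 + s ^ 2 = 0 \<or> (r0 ^ 2 - s) ^ 2 = 2 * s ^ 2"
  shows "point_mult E 8 (half r0 r1 r2) = Infinity"
proof -
  obtain x y where xy: "half r0 r1 r2 = Point x y" "on_curve E (Point x y)"
    using half_of_roots[OF assms(1)] by metis
  obtain y' where y': "point_add E (Point x y) (Point x y) = Point (r0 ^ 2) y'"
    using point_mult_2_half[OF assms(1)] xy(1) by metis
  have "on_curve E (Point (r0 ^ 2) y')"
    using on_curve_point_add[OF xy(2,2)] y' by simp
  from torsion_4_iff[OF this] show ?thesis
    using assms(2) unfolding xy(1) point_mult_8_eq_Infinity_iff[OF elliptic xy(2)] y' by blast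
qed

lemma torsion_4_half:
  assumes "half_roots r0 r1 r2" "r0 ^ 2 \<in> {0, s, - s}"
  shows "point_mult E 4 (half r0 r1 r2) = Infinity"
proof -
  obtain x y where xy: "half r0 r1 r2 = Point x y" "on_curve E (Point x y)"
    using half_of_roots[OF assms(1)] by metis
  obtain y' where y': "point_add E (Point x y) (Point x y) = Point (r0 ^ 2) y'"
    using point_mult_2_half[OF assms(1)] xy(1) by metis
  show ?thesis
    using torsion_4_iff_double[OF xy(2) y'] assms(2) unfolding xy(1) by blast
qed

end

section \<open>Bounds for the torsion fields\<close>

text \<open>
  The complex model \<open>y\<^sup>2 = x\<^sup>3 - s\<^sup>2 x\<close> of the rational curve \<open>y\<^sup>2 = x\<^sup>3 - N x\<close>, and its torsion
  fields \<open>T n\<close>.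
\<close>

locale rational_congruent_curve = congruent_curve s for s :: complex +
  fixes N :: rat
  assumes s_square: "s ^ 2 = of_rat N"
begin

abbreviation T :: "nat \<Rightarrow> complex set" where
  "T n \<equiv> torsion_field (Short_Weierstrass (- N) 0) n"

sublocale T: complex_subfield "T n" for n
  unfolding torsion_field_def by (rule complex_subfield_rat_adjoin)

sublocale Qbar: complex_subfield Qbar
  by (rule complex_subfield_Qbar)

lemma torsion_points_eq:
  "torsion_points (Short_Weierstrass (- N) 0) n =
    {P. on_curve E P \<and> coords P \<subseteq> Qbar \<and> point_mult E n P = Infinity}"
  by (simp add: torsion_points_eq s_square of_rat_minus)

lemma torsion_field_least:
  assumes "complex_subfield K"
    and "\<And>x y. on_curve E (Point x y) \<Longrightarrow> point_mult E n (Point x y) = Infinity \<Longrightarrow> x \<in> K \<and> y \<in> K"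
  shows "T n \<subseteq> K"
  unfolding torsion_field_def
proof (rule rat_adjoin_least[OF assms(1)])
  have "coords P \<subseteq> K" if "on_curve E P" "point_mult E n P = Infinity" for P
    using that assms(2) by (cases P) auto
  then show "(\<Union>P\<in>torsion_points (Short_Weierstrass (- N) 0) n. coords P) \<subseteq> K"
    by (auto simp: torsion_points_eq)
qed

lemma torsion_point_coords_mem:
  assumes "on_curve E (Point x y)" "x \<in> Qbar" "y \<in> Qbar" "point_mult E n (Point x y) = Infinity"
  shows "x \<in> T n \<and> y \<in> T n"
proof -
  have "Point x y \<in> torsion_points (Short_Weierstrass (- N) 0) n"
    using assms by (simp add: torsion_points_eq del: on_curve.simps)
  then show ?thesis
    unfolding torsion_field_def by (auto intro!: rat_adjoin_incl bexI[of _ "Point x y"])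
qed

lemma s_in_Qbar: "s \<in> Qbar"
proof (rule Qbar_square_root)
  show "s ^ 2 \<in> Qbar"
    using Qbar.Rats_subset Rats_of_rat unfolding s_square by blast
qed

lemma s_mem:
  assumes "n \<in> {4, 8}"
  shows "s \<in> T n"
proof -
  have on: "on_curve E (Point s 0)"
    by (simp add: on_curve_iff del: on_curve.simps)
  have "point_mult E 4 (Point s 0) = Infinity"
    using torsion_4_iff[OF on] by simp
  then have "point_mult E n (Point s 0) = Infinity"
    using point_mult_4_imp_8[OF elliptic on] assms by blast
  then show ?thesis
    using torsion_point_coords_mem[OF on s_in_Qbar] Qbar.numeral_mem(1) by blast
qed

text \<open>
  Lower bounds for a torsion field come from halving: the roots that halve a point are rational
  in the coordinates of the half, so they lie in the field as soon as the half is a torsion point.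
\<close>

lemma half_roots_mem:
  assumes "half_roots r0 r1 r2" "r0 ^ 2 \<in> Qbar" "point_mult E n (half r0 r1 r2) = Infinity" "s \<in> T n"
  shows "r0 \<in> T n" "r1 \<in> T n" "r2 \<in> T n"
proof -
  have "r1 ^ 2 \<in> Qbar" "r2 ^ 2 \<in> Qbar"
    using assms(1,2) s_in_Qbar by (auto simp: half_roots_def intro: Qbar.add_mem Qbar.diff_mem)
  with assms(2) have r: "r0 \<in> Qbar" "r1 \<in> Qbar" "r2 \<in> Qbar"
    by (blast intro: Qbar_square_root)+
  obtain x y where xy: "half r0 r1 r2 = Point x y" "on_curve E (Point x y)"
    "r0 = (x ^ 2 + s ^ 2) / (2 * y)"
    "r1 = (x ^ 2 - 2 * s * x - s ^ 2) / (2 * y)"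
    "r2 = (x ^ 2 + 2 * s * x - s ^ 2) / (2 * y)"
    using half_of_roots[OF assms(1)] by metis
  have "x \<in> Qbar" "y \<in> Qbar"
    using r xy(1) by (auto simp: half_def intro!: Qbar.mult_mem Qbar.add_mem)
  with assms(3) xy(1,2) have "x \<in> T n \<and> y \<in> T n"
    by (intro torsion_point_coords_mem) simp_all
  then show "r0 \<in> T n" "r1 \<in> T n" "r2 \<in> T n"
    using assms(4) unfolding xy(3-5) by (auto intro!: T.mem_intros)
qed

text \<open>
  Halving the point \<open>(0, 0)\<close> with roots \<open>0\<close>, \<open>I a\<close>, \<open>a\<close> gives \<open>a\<close> and \<open>I\<close>; halving \<open>(s, 0)\<close> with roots
  \<open>a\<close>, \<open>0\<close>, \<open>q a\<close> gives \<open>q\<close>. Each statement quantifies over all square roots, so no choice of signs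
  is fixed.
\<close>

lemma torsion_field_4_8_mem:
  assumes n: "n \<in> {4, 8}"
  shows "a ^ 2 = s \<Longrightarrow> a \<in> T n"
    and "I ^ 2 = - 1 \<Longrightarrow> I \<in> T n"
    and "q ^ 2 = 2 \<Longrightarrow> q \<in> T n"
proof -
  have mem: "r0 \<in> T n \<and> r1 \<in> T n \<and> r2 \<in> T n"
    if roots: "half_roots r0 r1 r2" "r0 ^ 2 \<in> {0, s, - s}" for r0 r1 r2
  proof -
    obtain x y where "half r0 r1 r2 = Point x y" "on_curve E (Point x y)"
      using half_of_roots[OF roots(1)] by metis
    then have "point_mult E n (half r0 r1 r2) = Infinity"
      using torsion_4_half[OF roots] point_mult_4_imp_8[OF elliptic] n by auto
    moreover have "r0 ^ 2 \<in> Qbar"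
      using roots(2) s_in_Qbar by (auto intro: Qbar.mem_intros)
    ultimately show ?thesis
      using half_roots_mem[OF roots(1)] s_mem[OF n] by blast
  qed
  have a: "b \<in> T n" "\<i> * b \<in> T n" if "b ^ 2 = s" for b
    using mem[of 0 "\<i> * b" b] that by (simp_all add: half_roots_def power_mult_distrib)
  show "a \<in> T n" if "a ^ 2 = s" using a(1)[OF that] .
  have b: "csqrt s ^ 2 = s" "csqrt s \<noteq> 0"
    using s_nz by simp_all
  have "\<i> * csqrt s / csqrt s \<in> T n"
    using a[OF b(1)] by (intro T.divide_mem)
  with b(2) have "\<i> \<in> T n" by simp
  then show "I \<in> T n" if "I ^ 2 = - 1"
    by (rule T.square_root_mem) (simp add: that)
  assume "q ^ 2 = 2"
  then have "q * csqrt s \<in> T n"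
    using mem[of "csqrt s" 0 "q * csqrt s"] b by (simp add: half_roots_def power_mult_distrib)
  then have "q * csqrt s / csqrt s \<in> T n"
    using a[OF b(1)] by (intro T.divide_mem)
  with b(2) show "q \<in> T n" by simp
qed

text \<open>
  These come from halving the points of order 4 with the abscissae \<open>(q + 1) s\<close> and \<open>I s\<close>.
\<close>

lemma torsion_field_8_mem:
  assumes q: "q ^ 2 = 2"
  shows "g ^ 2 = q \<Longrightarrow> g \<in> T 8"
    and "t ^ 2 = q - 1 \<Longrightarrow> t \<in> T 8"
    and "I ^ 2 = - 1 \<Longrightarrow> b ^ 2 = I + 1 \<Longrightarrow> b \<in> T 8"
proof -
  define a where "a = csqrt s"
  have a: "a ^ 2 = s" "a \<noteq> 0" "a \<in> T 8"
    using s_nz torsion_field_4_8_mem(1)[of 8] by (simp_all add: a_def)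
  note s = s_mem[of 8, simplified]
  have cancel: "c \<in> T 8" if "c * a \<in> T 8" for c
    using T.divide_mem[OF that a(3)] a(2) by simp
  have q': "q \<in> Qbar"
    by (rule Qbar_square_root) (simp add: q Qbar.numeral_mem)
  have gt: "g \<in> T 8 \<and> t \<in> T 8" if g: "g ^ 2 = q" and t: "t ^ 2 = q - 1" for g t
  proof -
    have t': "inverse t ^ 2 = q + 1"
      unfolding power_inverse t using q
      by (intro inverse_unique) (simp add: algebra_simps power2_eq_square)
    have roots: "half_roots (inverse t * a) (g * a) (csqrt (2 + q) * a)"
      unfolding half_roots_def power_mult_distrib t' g a(1) by (simp add: algebra_simps)
    have eq: "(inverse t * a) ^ 2 = (q + 1) * s"
      by (simp only: power_mult_distrib t' a(1))
    have "(q + 1) * s - s = q * s"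
      by (simp add: algebra_simps)
    then have "((inverse t * a) ^ 2 - s) ^ 2 = 2 * s ^ 2"
      unfolding eq by (simp add: power_mult_distrib q)
    with torsion_8_half[OF roots]
    have "point_mult E 8 (half (inverse t * a) (g * a) (csqrt (2 + q) * a)) = Infinity"
      by blast
    moreover have "(inverse t * a) ^ 2 \<in> Qbar"
      unfolding eq by (intro Qbar.mem_intros q' s_in_Qbar)
    ultimately have "inverse t * a \<in> T 8" "g * a \<in> T 8"
      using half_roots_mem[OF roots] s by blast+
    then have "inverse (inverse t) \<in> T 8" "g \<in> T 8"
      by (blast intro: cancel T.inverse_mem)+
    then show ?thesis by simp
  qed
  show "g \<in> T 8" if "g ^ 2 = q"
    using gt[OF that, of "csqrt (q - 1)"] by simp
  show "t \<in> T 8" if "t ^ 2 = q - 1"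
    using gt[OF _ that, of "csqrt q"] by simp
  assume I: "I ^ 2 = - 1" and b: "b ^ 2 = I + 1"
  have I': "I \<in> Qbar"
    by (rule Qbar_square_root) (simp add: I Qbar.numeral_mem Qbar.uminus_mem)
  have roots: "half_roots (csqrt I * a) (csqrt (I - 1) * a) (b * a)"
    unfolding half_roots_def power_mult_distrib power2_csqrt a(1) b by (simp add: algebra_simps)
  have eq: "(csqrt I * a) ^ 2 = I * s"
    by (simp only: power_mult_distrib power2_csqrt a(1))
  have "((csqrt I * a) ^ 2) ^ 2 + s ^ 2 = 0"
    unfolding eq by (simp add: power_mult_distrib I)
  with torsion_8_half[OF roots]
  have "point_mult E 8 (half (csqrt I * a) (csqrt (I - 1) * a) (b * a)) = Infinity"
    by blast
  moreover have "(csqrt I * a) ^ 2 \<in> Qbar"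
    unfolding eq by (intro Qbar.mem_intros s_in_Qbar) (rule I')
  ultimately have "b * a \<in> T 8"
    using half_roots_mem(3)[OF roots] s by blast
  then show "b \<in> T 8" by (rule cancel)
qed

end

text \<open>
  Upper bounds for a torsion field: a subfield \<open>K\<close> contains the coordinates of a point as soon as
  it contains the three roots that halve its double.
\<close>

locale curve_over_subfield = rational_congruent_curve + complex_subfield K for K +
  assumes square_s: "square_in s" and square_minus_1: "square_in (- 1)" and square_2: "square_in 2"
begin

lemma coords_mem:
  assumes P: "on_curve E (Point x y)" and double: "point_add E (Point x y) (Point x y) = Point (u * s) y'"
    and u: "square_in u" "square_in (u - 1)" "square_in (u + 1)"
  shows "x \<in> K \<and> y \<in> K"
proof (cases "y = 0")
  case True
  then show ?thesis
    using ordinate_zero_iff[OF P] square_in_mem[OF square_s] by (auto intro: mem_intros)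
next
  case False
  obtain r0 r1 r2 where r: "half_roots r0 r1 r2" "Point x y = half r0 r1 r2"
    "\<exists>y'. point_add E (Point x y) (Point x y) = Point (r0 ^ 2) y'"
    using roots_of_half[OF P False] by blast
  then have "r0 ^ 2 = u * s" "r1 ^ 2 = (u - 1) * s" "r2 ^ 2 = (u + 1) * s"
    using double by (auto simp: half_roots_def algebra_simps simp del: point_add.simps)
  then have "r0 \<in> K" "r1 \<in> K" "r2 \<in> K"
    using u square_s by (auto intro!: square_in_imp_mem square_in_mult)
  then show ?thesis
    using r(2) by (auto simp: half_def intro!: mem_intros)
qed

lemma coords_mem_2:
  assumes "on_curve E (Point x y)" "x \<in> {0, s, - s}"
  shows "x \<in> K \<and> y \<in> K"
  using ordinate_zero_iff[OF assms(1)] assms(2) square_in_mem[OF square_s] by (auto intro: mem_intros)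

lemma coords_mem_4:
  assumes P: "on_curve E (Point x y)" and double: "point_add E (Point x y) (Point x y) = Point x' y'"
    and x': "x' \<in> {0, s, - s}"
  shows "x \<in> K \<and> y \<in> K"
proof -
  have minus_2: "square_in (- 2)"
    using square_in_uminus[OF square_minus_1 square_2] .
  have "\<exists>u\<in>{0, 1, - 1}. x' = u * s"
    using x' by auto
  then obtain u where u: "x' = u * s" "u \<in> {0, 1, - 1}"
    by blast
  show ?thesis
    by (rule coords_mem[OF P double[unfolded u(1)]])
      (use u(2) square_in_0_1 square_minus_1 square_2 minus_2 in auto)
qed

lemma torsion_field_4_subset: "T 4 \<subseteq> K"
proof (rule torsion_field_least)
  fix x y assume P: "on_curve E (Point x y)" and 4: "point_mult E 4 (Point x y) = Infinity"
  show "x \<in> K \<and> y \<in> K"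
  proof (cases "point_add E (Point x y) (Point x y)")
    case Infinity
    then have "x \<in> {0, s, - s}"
      using torsion_2_iff[OF P] by (simp add: point_mult_2 del: point_add.simps)
    then show ?thesis by (rule coords_mem_2[OF P])
  next
    case (Point x' y')
    then show ?thesis
      using coords_mem_4[OF P Point] torsion_4_iff_double[OF P Point] 4 by blast
  qed
qed (fact complex_subfield_axioms)

text \<open>
  The abscissae of the points of order 4 are \<open>u s\<close> with \<open>u = \<plusminus> I\<close>, \<open>\<plusminus> (q + 1)\<close>, \<open>\<plusminus> (q - 1)\<close>, so the
  doubles of 8-torsion points can be halved in \<open>K\<close> if \<open>u\<close>, \<open>u - 1\<close> and \<open>u + 1\<close> are squares there.
  The missing ones are obtained from \<open>(q - 1) (q + 1) = 1\<close>, \<open>2 - q = q (q - 1)\<close> and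
  \<open>I - 1 = I (I + 1)\<close>.
\<close>

lemma torsion_field_8_subset:
  assumes q: "q ^ 2 = 2" and squares: "square_in q" "square_in (q - 1)" "square_in (2 + q)"
    and I: "I ^ 2 = - 1" and squares_I: "square_in I" "square_in (I + 1)"
  shows "T 8 \<subseteq> K"
proof (rule torsion_field_least)
  note minus = square_in_uminus[OF square_minus_1]
  have "inverse (q - 1) = q + 1"
    using q by (intro inverse_unique) (simp add: algebra_simps power2_eq_square)
  with square_in_inverse[OF squares(2)] have q1: "square_in (q + 1)"
    by simp
  have "q * (q - 1) = 2 - q"
    using q by (simp add: algebra_simps power2_eq_square)
  with square_in_mult[OF squares(1,2)] have q2: "square_in (2 - q)"
    by simp
  have "I * (I + 1) = I - 1"
    using I by (simp add: algebra_simps power2_eq_square)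
  with square_in_mult[OF squares_I] have I1: "square_in (I - 1)"
    by simp
  have "q + 1 + 1 = 2 + q" "q - 1 - 1 = - (2 - q)"
    by simp_all
  then have squares_u: "square_in u \<and> square_in (u - 1) \<and> square_in (u + 1)"
    if "u \<in> {I, q + 1, q - 1}" for u
    using that squares squares_I q1 minus[OF q2] I1 by auto
  have squares_minus_u: "square_in (- u) \<and> square_in (- u - 1) \<and> square_in (- u + 1)"
    if "u \<in> {I, q + 1, q - 1}" for u
  proof -
    have "- u - 1 = - (u + 1)" "- u + 1 = - (u - 1)"
      by simp_all
    then show ?thesis
      using squares_u[OF that] minus by metis
  qed
  fix x y assume P: "on_curve E (Point x y)" and 8: "point_mult E 8 (Point x y) = Infinity"
  show "x \<in> K \<and> y \<in> K"
  proof (cases "point_add E (Point x y) (Point x y)")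
    case Infinity
    then have "x \<in> {0, s, - s}"
      using torsion_2_iff[OF P] by (simp add: point_mult_2 del: point_add.simps)
    then show ?thesis by (rule coords_mem_2[OF P])
  next
    case (Point x' y')
    have on: "on_curve E (Point x' y')"
      using on_curve_point_add[OF P P] Point by simp
    have "point_mult E 4 (Point x' y') = Infinity"
      using 8 unfolding point_mult_8_eq_Infinity_iff[OF elliptic P] Point .
    then consider "x' \<in> {0, s, - s}" | "x' ^ 2 = (I * s) ^ 2" | "(x' - s) ^ 2 = (q * s) ^ 2"
      | "(x' + s) ^ 2 = (q * s) ^ 2"
      unfolding torsion_4_iff[OF on] power_mult_distrib q I by (auto simp: eq_neg_iff_add_eq_0)
    then show ?thesis
    proof cases
      case 1
      then show ?thesis by (rule coords_mem_4[OF P Point])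
    next
      case 2
      then have "x' = I * s \<or> x' = - I * s"
        by (simp add: power2_eq_iff)
      then show ?thesis
        using Point squares_u[of I] squares_minus_u[of I] coords_mem[OF P] by blast
    next
      case 3
      then have "x' - s = q * s \<or> x' - s = - (q * s)"
        by (simp only: power2_eq_iff)
      then have "x' = (q + 1) * s \<or> x' = - (q - 1) * s"
        by (auto simp: algebra_simps)
      then show ?thesis
        using Point squares_u[of "q + 1"] squares_minus_u[of "q - 1"] coords_mem[OF P] by blast
    next
      case 4
      then have "x' + s = q * s \<or> x' + s = - (q * s)"
        by (simp only: power2_eq_iff)
      then have "x' = q * s - s \<or> x' = - (q * s) - s"
        by (simp only: eq_diff_eq)
      then have "x' = (q - 1) * s \<or> x' = - (q + 1) * s"
        by (simp add: left_diff_distrib)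
      then show ?thesis
        using Point squares_u[of "q - 1"] squares_minus_u[of "q + 1"] coords_mem[OF P] by blast
    qed
  qed
qed (fact complex_subfield_axioms)

end

section \<open>Generators of the 4- and 8-torsion fields\<close>

lemma primitive_root_of_unity_16:
  assumes "primitive_root_of_unity 16 (\<zeta> :: complex)"
  shows "\<zeta> ^ 8 = - 1"
proof -
  have "(\<zeta> ^ 8) ^ 2 = 1" "\<zeta> ^ 8 \<noteq> 1"
    using assms by (auto simp: primitive_root_of_unity_def simp flip: power_mult)
  then show ?thesis
    by (metis power2_eq_1_iff)
qed

lemma inverse_root_of_minus_1:
  fixes z :: complex
  assumes "z ^ 4 = - 1"
  shows "z \<noteq> 0" "(z ^ 2) ^ 2 = - 1" "inverse z = - (z ^ 3)" "(z + inverse z) ^ 2 = 2"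
    "z * (z + inverse z) = z ^ 2 + 1"
proof -
  show z: "z \<noteq> 0"
    using assms by auto
  show "(z ^ 2) ^ 2 = - 1"
    using assms by (simp flip: power_mult)
  show inv: "inverse z = - (z ^ 3)"
    using assms by (intro inverse_unique) (simp add: power4_eq_xxxx power3_eq_cube mult.assoc)
  show *: "z * (z + inverse z) = z ^ 2 + 1"
    using z by (simp add: distrib_left power2_eq_square)
  have "(z + inverse z) ^ 2 = z ^ 2 + 2 + inverse z * inverse z"
    using z by (simp add: power2_eq_square algebra_simps)
  also have "inverse z * inverse z = z ^ 4 * z ^ 2"
    unfolding inv by (simp flip: power_add)
  finally show "(z + inverse z) ^ 2 = 2"
    using assms by simp
qed

context rational_congruent_curve
begin

lemma torsion_field_4:
  assumes a: "a ^ 2 = s" and z: "z ^ 4 = - 1"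
  shows "T 4 = rat_adjoin {z, a}"
proof
  let ?K = "rat_adjoin {z, a}"
  interpret K: complex_subfield ?K
    by (rule complex_subfield_rat_adjoin)
  have mem: "z \<in> ?K" "a \<in> ?K"
    by (auto intro: rat_adjoin_incl)
  note z' = inverse_root_of_minus_1[OF z]
  interpret curve_over_subfield s N ?K
  proof
    show "K.square_in s"
      using mem a by (intro K.square_inI[of a]) auto
    show "K.square_in (- 1)"
      using mem z'(2) by (intro K.square_inI[of "z ^ 2"]) (auto intro: K.mem_intros)
    show "K.square_in 2"
      using mem z'(4) by (intro K.square_inI[of "z + inverse z"]) (auto intro: K.mem_intros)
  qed
  show "T 4 \<subseteq> ?K"
    by (rule torsion_field_4_subset)
  have "z + inverse z \<in> T 4" "z ^ 2 \<in> T 4"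
    using torsion_field_4_8_mem(2,3)[of 4] z'(2,4) by blast+
  then have "(z ^ 2 + 1) / (z + inverse z) \<in> T 4"
    by (blast intro: T.divide_mem T.add_mem T.numeral_mem)
  moreover have "(z ^ 2 + 1) / (z + inverse z) = z"
  proof -
    have "z + inverse z \<noteq> 0"
      using z'(4) by auto
    then show ?thesis
      unfolding z'(5)[symmetric] by simp
  qed
  moreover have "a \<in> T 4"
    using torsion_field_4_8_mem(1)[OF _ a] by blast
  ultimately show "?K \<subseteq> T 4"
    by (intro rat_adjoin_least T.complex_subfield_axioms) auto
qed

text \<open>
  Here \<open>h = \<zeta>\<^sup>2 + \<zeta>\<^bsup>-2\<^esup>\<close> is \<open>q\<close> or \<open>- q\<close>, depending on \<open>\<zeta>\<close>. In both cases the field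
  generated by \<open>\<zeta>\<close>, \<open>t\<close> and \<open>a\<close> contains a square root \<open>w\<close> of \<open>2 + q\<close>,
  hence also the square root \<open>w t\<close> of \<open>q\<close>.
\<close>

lemma torsion_field_8:
  assumes a: "a ^ 2 = s" and \<zeta>: "\<zeta> ^ 8 = - 1" and q: "q ^ 2 = 2" and t: "t ^ 2 = q - 1"
  shows "T 8 = rat_adjoin {\<zeta>, t, a}"
proof
  let ?K = "rat_adjoin {\<zeta>, t, a}"
  interpret K: complex_subfield ?K
    by (rule complex_subfield_rat_adjoin)
  have mem: "\<zeta> \<in> ?K" "t \<in> ?K" "a \<in> ?K"
    by (auto intro: rat_adjoin_incl)
  define z where "z = \<zeta> ^ 2"
  define h where "h = z + inverse z"
  have "z ^ 4 = - 1"
    using \<zeta> by (simp add: z_def flip: power_mult)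
  note z = inverse_root_of_minus_1[OF this, folded h_def]
  have zK: "z \<in> ?K"
    using mem by (auto simp: z_def intro: K.mem_intros)
  then have hK: "h \<in> ?K"
    by (auto simp: h_def intro: K.mem_intros)
  have h: "h = q \<or> h = - q"
    using z(4) q by (simp flip: power2_eq_iff)
  have minus_1: "K.square_in (- 1)"
    using zK z(2) by (intro K.square_inI[of "z ^ 2"]) (auto intro: K.mem_intros)
  have sum_inverse_square: "(w + inverse w) ^ 2 = 2 + (w ^ 2 + inverse (w ^ 2))"
    if "w \<noteq> 0" for w :: complex
    using that by (simp add: power2_sum power_inverse)
  have "\<zeta> \<noteq> 0"
    using z(1) by (auto simp: z_def)
  \<comment> \<open>A square root of \<open>2 + q\<close> is \<open>\<zeta> + \<zeta>\<^bsup>-1\<^esup>\<close> or \<open>\<zeta>\<^sup>3 + \<zeta>\<^bsup>-3\<^esup>\<close>, depending on the sign in \<open>h = \<plusminus> q\<close>.\<close>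
  have "K.square_in (2 + q)"
    using h
  proof
    have "(\<zeta> + inverse \<zeta>) ^ 2 = 2 + h"
      using sum_inverse_square[OF \<open>\<zeta> \<noteq> 0\<close>] by (simp add: h_def z_def)
    moreover assume "h = q"
    ultimately show ?thesis
      using mem by (intro K.square_inI[of "\<zeta> + inverse \<zeta>"]) (auto intro: K.mem_intros)
  next
    have "(\<zeta> ^ 3 + inverse (\<zeta> ^ 3)) ^ 2 = 2 + (z ^ 3 + inverse (z ^ 3))"
      using sum_inverse_square[of "\<zeta> ^ 3"] \<open>\<zeta> \<noteq> 0\<close> by (simp add: z_def flip: power_mult)
    moreover have "z ^ 3 + inverse (z ^ 3) = - h"
    proof -
      have "z ^ 3 = - inverse z"
        using z(3) by simp
      then show ?thesis
        by (simp add: h_def)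
    qed
    moreover assume "h = - q"
    ultimately show ?thesis
      using mem by (intro K.square_inI[of "\<zeta> ^ 3 + inverse (\<zeta> ^ 3)"]) (auto intro: K.mem_intros)
  qed
  moreover have q1: "K.square_in (q - 1)"
    using mem t by (intro K.square_inI[of t]) auto
  moreover have "(2 + q) * (q - 1) = q"
    using q by (simp add: algebra_simps power2_eq_square)
  ultimately have q2: "K.square_in (2 + q)" and qK: "K.square_in q"
    using K.square_in_mult by metis+
  have "K.square_in 2"
    using K.square_in_mem[OF qK] q by (intro K.square_inI[of q]) auto
  then interpret curve_over_subfield s N ?K
    using mem a minus_1 by unfold_locales (auto intro: K.square_inI)
  have "K.square_in h"
    using h qK K.square_in_uminus[OF minus_1 qK] by auto
  moreover have Kz: "K.square_in z"
    using mem(1) by (intro K.square_inI[of \<zeta>]) (auto simp: z_def)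
  ultimately have I1: "K.square_in (z ^ 2 + 1)"
    using K.square_in_mult[of z h] z(5) by simp
  have "K.square_in (z ^ 2)"
    using zK by (rule K.square_inI) simp
  with q qK q1 q2 z(2) I1 show "T 8 \<subseteq> ?K"
    by (intro torsion_field_8_subset)
  have t8: "t \<in> T 8" and a8: "a \<in> T 8"
    using torsion_field_8_mem(2)[OF q t] torsion_field_4_8_mem(1)[OF _ a] by blast+
  obtain k where k: "k ^ 2 = h" "k \<in> T 8"
  proof (cases "h = q")
    case True
    then show thesis
      using torsion_field_8_mem(1)[OF q, of "csqrt q"] that[of "csqrt q"] by simp
  next
    case False
    with h have "(\<i> * csqrt q) ^ 2 = h"
      by (simp add: power_mult_distrib)
    moreover have "\<i> * csqrt q \<in> T 8"
      using torsion_field_8_mem(1)[OF q, of "csqrt q"] torsion_field_4_8_mem(2)[of 8 \<i>]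
      by (intro T.mult_mem) auto
    ultimately show thesis by (rule that)
  qed
  \<comment> \<open>Both \<open>\<zeta> k\<close>, a square root of \<open>z\<^sup>2 + 1\<close> with \<open>z\<^sup>2 = \<plusminus> \<i>\<close>, and \<open>k\<close> lie in the torsion field.\<close>
  have "(\<zeta> * k) ^ 2 = z ^ 2 + 1"
    by (simp only: power_mult_distrib k(1) z(5) flip: z_def)
  then have "\<zeta> * k / k \<in> T 8"
    using torsion_field_8_mem(3)[OF q z(2)] k(2) by (intro T.divide_mem)
  moreover have "k \<noteq> 0"
    using k(1) z(4) by auto
  ultimately have "\<zeta> \<in> T 8"
    by simp
  with t8 a8 show "?K \<subseteq> T 8"
    by (intro rat_adjoin_least T.complex_subfield_axioms) auto
qed

end

theorem corollary3p1:
  fixes E :: "rat short_weierstrass" and N :: rat and \<zeta>\<^sub>1\<^sub>6 \<zeta>\<^sub>8 :: complex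
  assumes "elliptic_curve E"
    and "j_invariant E = 1728"
    and "E = Short_Weierstrass (- N) 0"
    and "N > 0"
    and "primitive_root_of_unity 16 \<zeta>\<^sub>1\<^sub>6"
    and "\<zeta>\<^sub>8 = \<zeta>\<^sub>1\<^sub>6 ^ 2"
  shows "torsion_field E 4 = rat_adjoin {\<zeta>\<^sub>8, complex_of_real (root 4 (of_rat N))}
       \<and> torsion_field E 8 =
           rat_adjoin {\<zeta>\<^sub>1\<^sub>6, complex_of_real (sqrt (-1 + sqrt 2)), complex_of_real (root 4 (of_rat N))}"
proof -
  define a where "a = complex_of_real (root 4 (of_rat N))"
  define q where "q = complex_of_real (sqrt 2)"
  define t where "t = complex_of_real (sqrt (- 1 + sqrt 2))"
  have "root 4 (of_rat N) ^ 4 = (of_rat N :: real)"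
    using assms(4) by (intro real_root_pow_pos2) auto
  then have "(a ^ 2) ^ 2 = complex_of_real (of_rat N)"
    unfolding a_def of_real_power[symmetric] by (simp flip: power_mult)
  moreover have "complex_of_real (of_rat N) = of_rat N"
    by (cases N) (simp add: of_rat_rat)
  ultimately have s: "(a ^ 2) ^ 2 = of_rat N"
    by simp
  interpret rational_congruent_curve "a ^ 2" N
    using assms(4) s by unfold_locales auto
  have q: "q ^ 2 = 2"
    unfolding q_def of_real_power[symmetric] by simp
  have "t ^ 2 = complex_of_real (- 1 + sqrt 2)"
    unfolding t_def of_real_power[symmetric] by simp
  then have t: "t ^ 2 = q - 1"
    by (simp add: q_def)
  note \<zeta> = primitive_root_of_unity_16[OF assms(5)]
  then have "\<zeta>\<^sub>8 ^ 4 = - 1"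
    by (simp add: assms(6) flip: power_mult)
  then show ?thesis
    using torsion_field_4[OF refl] torsion_field_8[OF refl \<zeta> q t]
    by (simp add: assms(3) a_def t_def)
qed

end
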